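(* For every integer $n\geq 4$ there exists a multi-layer graph $\mathcal{G}=(V,\{C_H,C_V\},* )$ with $|V|=n^2$ such that: the cop player has a winning strategy with two cops if both cops are allocated to $C_H$ (allocation $(2,0)$), and also if both cops are allocated to $C_V$ (allocation $(0,2)$); but the robber player has a winning strategy against two cops if one cop is allocated to $C_H$ and the other to $C_V$ (allocation $(1,1)$).
   Context: A multi-layer graph with designated layers is $\mathcal{G}=(V,\{C_1,\dots,C_\tau\},R)$ where $V$ is a finite vertex set, $\tau\geq 1$, and the cop layers $C_1,\dots,C_\tau$ and the robber layer $R$ are subsets of $\binom{V}{2}$; the notation $(V,\{C_1,\dots,C_\tau\},* )$ means $R=C_1\cup\dots\cup C_\tau$. Given an allocation $(k_1,\dots,k_\tau)$ of nonnegative integers, the game is: $k_i$ cops are assigned to layer $C_i$; the cop player places every cop on a vertex, then the robber player places the robber on a vertex; then turns alternate starting with the cop player. On the cop player's turn each cop either stays put or moves along one edge of its own layer; on the robber's turn the robber stays or moves along one edge of $R$. No agent ever changes layer. The cop player wins if at some point a cop occupies the robber's vertex; the robber wins if it evades capture forever. Both players have perfect information. *)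

theory Defs
  imports "HOL-Library.Ramsey" "HOL-Library.FuncSet"
begin

text \<open>
  Layers are sets of two-element vertex sets. The cop layers form a list, so that they are indexed
  by \<open>0, \<dots>, \<tau> - 1\<close>, matching the indices of an allocation.
\<close>

record 'a mlgraph =
  verts :: "'a set"
  cop_layers :: "'a set set list"
  robber_layer :: "'a set set"

definition multilayer_graph :: "'a mlgraph \<Rightarrow> bool" where
  "multilayer_graph G \<longleftrightarrow>
     finite (verts G) \<and>
     length (cop_layers G) \<ge> 1 \<and>
     (\<forall>C \<in> set (cop_layers G). C \<subseteq> nsets (verts G) 2) \<and>
     robber_layer G \<subseteq> nsets (verts G) 2"

text \<open>The graph written \<open>(V, {C\<^sub>1, \<dots>, C\<^sub>\<tau>}, *)\<close>.\<close>

definition star_mlgraph :: "'a set \<Rightarrow> 'a set set list \<Rightarrow> 'a mlgraph" where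
  "star_mlgraph V Cs = \<lparr>verts = V, cop_layers = Cs, robber_layer = \<Union> (set Cs)\<rparr>"

definition step :: "'a set set \<Rightarrow> 'a \<Rightarrow> 'a \<Rightarrow> bool" where
  "step E u v \<longleftrightarrow> u = v \<or> {u, v} \<in> E"

text \<open>
  The cop \<open>(i, j)\<close> is the \<open>j\<close>-th of the \<open>ks ! i\<close> cops assigned to layer \<open>i\<close>.
\<close>

definition cops :: "nat list \<Rightarrow> (nat \<times> nat) set" where
  "cops ks = (SIGMA i:{..<length ks}. {..<ks ! i})"

type_synonym 'a placement = "nat \<times> nat \<Rightarrow> 'a"

text \<open>
  A play consists of \<open>c 0\<close>, \<open>r 0\<close> (initial placement of the cops, then of the robber), followed by
  \<open>c 1\<close>, \<open>r 1\<close>, \<open>c 2\<close>, \<open>r 2\<close>, \dots. Plays are continued beyond a capture; this affects neither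
  player, since staying put is always allowed.
\<close>

definition legal_cops :: "'a mlgraph \<Rightarrow> nat list \<Rightarrow> (nat \<Rightarrow> 'a placement) \<Rightarrow> bool" where
  "legal_cops G ks c \<longleftrightarrow>
     (\<forall>t. c t \<in> cops ks \<rightarrow>\<^sub>E verts G) \<and>
     (\<forall>t. \<forall>(i, j) \<in> cops ks. step (cop_layers G ! i) (c t (i, j)) (c (Suc t) (i, j)))"

definition legal_robber :: "'a mlgraph \<Rightarrow> (nat \<Rightarrow> 'a) \<Rightarrow> bool" where
  "legal_robber G r \<longleftrightarrow>
     (\<forall>t. r t \<in> verts G) \<and> (\<forall>t. step (robber_layer G) (r t) (r (Suc t)))"

text \<open>
  The two disjuncts are the situation after the robber's turn and after the cops' next turn.
\<close>

definition captured :: "nat list \<Rightarrow> (nat \<Rightarrow> 'a placement) \<Rightarrow> (nat \<Rightarrow> 'a) \<Rightarrow> bool" where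
  "captured ks c r \<longleftrightarrow> (\<exists>t. \<exists>x \<in> cops ks. c t x = r t \<or> c (Suc t) x = r t)"

definition history :: "(nat \<Rightarrow> 'a placement) \<Rightarrow> (nat \<Rightarrow> 'a) \<Rightarrow> nat \<Rightarrow> ('a placement \<times> 'a) list" where
  "history c r t = map (\<lambda>s. (c s, r s)) [0..<t]"

text \<open>
  Strategies see the entire history of the play. A cop strategy maps the completed rounds to the
  next placement of the cops (the empty history to the initial one); a robber strategy additionally
  sees the cops' move of the current round. Against every sequence of opponent moves there is exactly
  one play following a given strategy. A winning strategy must itself produce legal moves.
\<close>

type_synonym 'a cop_strategy = "('a placement \<times> 'a) list \<Rightarrow> 'a placement"

type_synonym 'a robber_strategy = "('a placement \<times> 'a) list \<Rightarrow> 'a placement \<Rightarrow> 'a"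

definition winning_cop_strategy :: "'a mlgraph \<Rightarrow> nat list \<Rightarrow> 'a cop_strategy \<Rightarrow> bool" where
  "winning_cop_strategy G ks \<sigma> \<longleftrightarrow>
     (\<forall>c r. (\<forall>t. c t = \<sigma> (history c r t)) \<and> legal_robber G r \<longrightarrow>
        legal_cops G ks c \<and> captured ks c r)"

definition winning_robber_strategy :: "'a mlgraph \<Rightarrow> nat list \<Rightarrow> 'a robber_strategy \<Rightarrow> bool" where
  "winning_robber_strategy G ks \<rho> \<longleftrightarrow>
     (\<forall>c r. (\<forall>t. r t = \<rho> (history c r t) (c t)) \<and> legal_cops G ks c \<longrightarrow>
        legal_robber G r \<and> \<not> captured ks c r)"

definition cops_win :: "'a mlgraph \<Rightarrow> nat list \<Rightarrow> bool" where
  "cops_win G ks \<longleftrightarrow> (\<exists>\<sigma>. winning_cop_strategy G ks \<sigma>)"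

definition robber_wins :: "'a mlgraph \<Rightarrow> nat list \<Rightarrow> bool" where
  "robber_wins G ks \<longleftrightarrow> (\<exists>\<rho>. winning_robber_strategy G ks \<rho>)"

end

(* Let both layers be disjoint unions of two cliques: C_H joins the vertices on the same side of a
   vertical cut of the n x n grid, C_V those on the same side of a horizontal cut. Two cops on one
   layer occupy both of its cliques and capture the robber on their first move. A cop never leaves
   its clique, so against one cop on each layer the robber waits in the quadrant that lies in
   neither cop's clique. *)

theory Submission
  imports Defs
begin

text \<open>The disjoint union of the complete graphs on the fibres of \<open>f\<close> in
  \<open>V\<close>. Giving the cliques by labels turns reachability in one move into equality of
  labels.\<close>

definition cluster_layer :: "'a set \<Rightarrow> ('a \<Rightarrow> 'b) \<Rightarrow> 'a set set" where
  "cluster_layer V f = {e \<in> nsets V 2. \<forall>u\<in>e. \<forall>v\<in>e. f u = f v}"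

lemma step_cluster_layer_iff:
  assumes "u \<in> V" "v \<in> V"
  shows "step (cluster_layer V f) u v \<longleftrightarrow> f u = f v"
proof (cases "u = v")
  case False
  with assms have "{u, v} \<in> nsets V 2"
    by (simp add: nsets_def)
  then show ?thesis
    using False by (auto simp: step_def cluster_layer_def)
qed (simp add: step_def)

lemma history_eq_Nil_iff [simp]: "history c r t = [] \<longleftrightarrow> t = 0"
  by (simp add: history_def)

lemma hd_history: "t > 0 \<Longrightarrow> hd (history c r t) = (c 0, r 0)"
  by (simp add: history_def hd_map)

lemma last_history_Suc [simp]: "last (history c r (Suc t)) = (c t, r t)"
  by (simp add: history_def)

text \<open>Some cop starts in the robber's cluster and reaches the robber in a single move. The
  assumption on \<open>step\<close> concerns only layers that hold a cop, so one labelling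
  \<open>f\<close> is enough when all cops share a layer.\<close>

lemma cops_win_if_clusters_occupied:
  assumes step: "\<And>i j u v. \<lbrakk>(i, j) \<in> cops ks; u \<in> verts G; v \<in> verts G; f u = f v\<rbrakk>
                   \<Longrightarrow> step (cop_layers G ! i) u v"
    and p: "\<And>x. x \<in> cops ks \<Longrightarrow> p x \<in> verts G"
    and occupied: "\<And>v. v \<in> verts G \<Longrightarrow> \<exists>x\<in>cops ks. f (p x) = f v"
  shows "cops_win G ks"
proof -
  \<comment> \<open>A cop whose starting cluster does not contain the robber goes to
    \<open>p x\<close>. Thus each cop stays in that cluster and every move is legal, even after a
    capture.\<close>
  define \<sigma> where "\<sigma> h = (\<lambda>x\<in>cops ks.
    if h \<noteq> [] \<and> f (snd (last h)) = f (p x) then snd (last h) else p x)" for h :: "('a placement \<times> 'a) list"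
  have "legal_cops G ks c \<and> captured ks c r"
    if c: "\<forall>t. c t = \<sigma> (history c r t)" and "legal_robber G r" for c r
  proof
    from \<open>legal_robber G r\<close> have r: "r t \<in> verts G" for t
      by (simp add: legal_robber_def)
    have c_0: "c 0 x = p x" if "x \<in> cops ks" for x
      using c[rule_format, of 0] that by (simp add: \<sigma>_def)
    have c_Suc: "c (Suc t) x = (if f (r t) = f (p x) then r t else p x)" if "x \<in> cops ks" for t x
      using c[rule_format, of "Suc t"] that by (simp add: \<sigma>_def)
    have inv: "c t x \<in> verts G \<and> f (c t x) = f (p x)" if "x \<in> cops ks" for t x
      using that p r by (cases t) (auto simp: c_0 c_Suc)
    have "c t \<in> extensional (cops ks)" for t
      using c[rule_format, of t] by (simp add: \<sigma>_def)
    with inv have "c t \<in> cops ks \<rightarrow>\<^sub>E verts G" for t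
      by (simp add: PiE_def)
    moreover have "step (cop_layers G ! i) (c t (i, j)) (c (Suc t) (i, j))" if "(i, j) \<in> cops ks" for t i j
      using that inv by (intro step[OF that]) simp_all
    ultimately show "legal_cops G ks c"
      by (auto simp: legal_cops_def)
    from occupied[OF r] obtain x where "x \<in> cops ks" "f (p x) = f (r 0)"
      by blast
    \<comment> \<open>Round 0 suffices, by the second disjunct of \<open>captured\<close>:
      \<open>c (Suc 0) x = r 0\<close>.\<close>
    then show "captured ks c r"
      unfolding captured_def by (metis c_Suc)
  qed
  then show ?thesis
    unfolding cops_win_def winning_cop_strategy_def by blast
qed

text \<open>The label of a cop under its own layer's labelling is invariant, so a vertex that
  differs from every cop in that label at the start is safe forever. The robber stays there.\<close>

lemma robber_wins_if_cluster_unoccupied: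
  assumes step: "\<And>i j u v. \<lbrakk>(i, j) \<in> cops ks; u \<in> verts G; v \<in> verts G; step (cop_layers G ! i) u v\<rbrakk>
                   \<Longrightarrow> f i u = f i v"
    and unoccupied: "\<And>q. q \<in> cops ks \<rightarrow>\<^sub>E verts G \<Longrightarrow>
                   \<exists>w\<in>verts G. \<forall>(i, j)\<in>cops ks. f i w \<noteq> f i (q (i, j))"
  shows "robber_wins G ks"
proof -
  have "\<forall>q\<in>cops ks \<rightarrow>\<^sub>E verts G. \<exists>w. w \<in> verts G \<and> (\<forall>(i, j)\<in>cops ks. f i w \<noteq> f i (q (i, j)))"
    using unoccupied by blast
  from bchoice[OF this] obtain w where w: "w q \<in> verts G" "(i, j) \<in> cops ks \<Longrightarrow> f i (w q) \<noteq> f i (q (i, j))"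
    if "q \<in> cops ks \<rightarrow>\<^sub>E verts G" for q i j
    by blast
  \<comment> \<open>In round 0 the initial placement is the argument \<open>q\<close>; later it is
    read off the first entry of the history.\<close>
  define \<rho> where "\<rho> h q = w (if h = [] then q else fst (hd h))" for h :: "('a placement \<times> 'a) list" and q
  have "legal_robber G r \<and> \<not> captured ks c r"
    if r: "\<forall>t. r t = \<rho> (history c r t) (c t)" and "legal_cops G ks c" for c r
  proof
    from \<open>legal_cops G ks c\<close> have c: "c t \<in> cops ks \<rightarrow>\<^sub>E verts G"
      and c_step: "(i, j) \<in> cops ks \<Longrightarrow> step (cop_layers G ! i) (c t (i, j)) (c (Suc t) (i, j))" for t i j
      by (auto simp: legal_cops_def)
    have r_eq: "r t = w (c 0)" for t
      using r[rule_format, of t] by (cases "t = 0") (simp_all add: \<rho>_def hd_history)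
    then show "legal_robber G r"
      using w(1)[OF c] by (simp add: legal_robber_def step_def)
    have inv: "f i (c t (i, j)) = f i (c 0 (i, j))" if "(i, j) \<in> cops ks" for t i j
    proof (induction t)
      case (Suc t)
      have "f i (c t (i, j)) = f i (c (Suc t) (i, j))"
        by (intro step[OF that] c_step[OF that] PiE_mem[OF c that])
      with Suc.IH show ?case
        by simp
    qed simp
    have "c t x \<noteq> r s" if "x \<in> cops ks" for t s x
      using inv w(2)[OF c] that by (cases x) (metis r_eq)
    then show "\<not> captured ks c r"
      by (auto simp: captured_def)
  qed
  then show ?thesis
    unfolding robber_wins_def winning_robber_strategy_def by blast
qed

theorem theorem3p1:
  fixes n :: nat
  assumes "n \<ge> 4"
  shows "\<exists>(V :: (nat \<times> nat) set) C\<^sub>H C\<^sub>V.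
           multilayer_graph (star_mlgraph V [C\<^sub>H, C\<^sub>V]) \<and>
           card V = n ^ 2 \<and>
           cops_win (star_mlgraph V [C\<^sub>H, C\<^sub>V]) [2, 0] \<and>
           cops_win (star_mlgraph V [C\<^sub>H, C\<^sub>V]) [0, 2] \<and>
           robber_wins (star_mlgraph V [C\<^sub>H, C\<^sub>V]) [1, 1]"
proof -
  define V where "V = {..<n} \<times> {..<n}"
  \<comment> \<open>The cuts split off the first column and the first row, so all witnesses below
    fit into the 2 x 2 corner.\<close>
  define h v where "h = (\<lambda>u :: nat \<times> nat. fst u = 0)" and "v = (\<lambda>u :: nat \<times> nat. snd u = 0)"
  define G where "G = star_mlgraph V [cluster_layer V h, cluster_layer V v]"
  have G_simps: "verts G = V" "cop_layers G = [cluster_layer V h, cluster_layer V v]"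
    by (simp_all add: G_def star_mlgraph_def)
  have V: "(a, b) \<in> V" if "a < 2" "b < 2" for a b
    using that assms by (auto simp: V_def)
  have "multilayer_graph G"
    by (auto simp: multilayer_graph_def G_def star_mlgraph_def V_def cluster_layer_def)
  moreover have "card V = n ^ 2"
    by (simp add: V_def power2_eq_square)
  moreover have "cops_win G [2, 0]"
  proof (rule cops_win_if_clusters_occupied[where f = h and p = "\<lambda>(i, j). (j, 0)"])
    show "\<exists>x\<in>cops [2, 0]. h (case x of (i, j) \<Rightarrow> (j, 0)) = h u" for u
      by (rule bexI[of _ "(0, if h u then 0 else 1)"]) (auto simp: h_def cops_def)
  qed (auto simp: cops_def G_simps step_cluster_layer_iff less_Suc_eq V)
  moreover have "cops_win G [0, 2]"
  proof (rule cops_win_if_clusters_occupied[where f = v and p = "\<lambda>(i, j). (0, j)"])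
    show "\<exists>x\<in>cops [0, 2]. v (case x of (i, j) \<Rightarrow> (0, j)) = v u" for u
      by (rule bexI[of _ "(1, if v u then 0 else 1)"]) (auto simp: v_def cops_def)
  qed (auto simp: cops_def G_simps step_cluster_layer_iff less_Suc_eq V)
  moreover have "robber_wins G [1, 1]"
  proof (rule robber_wins_if_cluster_unoccupied[where f = "\<lambda>i. if i = 0 then h else v"])
    fix q :: "(nat \<times> nat) placement"
    show "\<exists>w\<in>verts G. \<forall>(i, j)\<in>cops [1, 1].
            (if i = 0 then h else v) w \<noteq> (if i = 0 then h else v) (q (i, j))"
      \<comment> \<open>As \<open>h\<close> depends only on the first coordinate and
        \<open>v\<close> only on the second, both labels can be made opposite to those of the cops
        independently.\<close>
      by (rule bexI[of _ "(if h (q (0, 0)) then 1 else 0, if v (q (1, 0)) then 1 else 0)"])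
        (auto simp: cops_def G_simps h_def v_def less_Suc_eq V)
  qed (auto simp: cops_def G_simps step_cluster_layer_iff less_Suc_eq)
  ultimately show ?thesis
    unfolding G_def by blast
qed

end
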